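(* For every integer $n\geq 1$ there is a bijection between $\mathcal{A}(n)$ and $\mathcal{B}(n-1)$, and for every $n\geq 4$ the set $\mathcal{C}(n-1)$ is nonempty.
   Context: An overpartition of $n$ is a partition of $n$ in which the last occurrence of each part size may be overlined. Parts are ordered by $\overline{1}<1<\overline{2}<2<\cdots$. $\mathcal{A}(n)$ is the set of overpartitions of $n$ whose smallest part (in this order) is non-overlined. $\mathcal{B}(n-1)$ is the set of overpartitions $\lambda$ of $n-1$ such that, if $\overline{1}$ appears in $\lambda$ (and $\lambda$ has a part larger than $1$), then the smallest part larger than $1$ in $\lambda$ is at least $2$ plus the number of non-overlined parts equal to $1$ in $\lambda$. $\mathcal{C}(n-1)$ is the set of overpartitions of $n-1$ not in $\mathcal{B}(n-1)$, i.e. those in which $\overline{1}$ appears and the smallest part larger than $1$ is less than $2$ plus the number of non-overlined parts $1$. *)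

theory Defs
  imports "HOL-Library.Multiset"
begin

datatype part = Over (part_size: nat) | Plain (part_size: nat)

fun overlined :: "part \<Rightarrow> bool" where
  "overlined (Over k) = True"
| "overlined (Plain k) = False"

text \<open>The order on parts: an overlined part comes directly before the plain part of the same size.\<close>

instantiation part :: linorder
begin

definition less_part :: "part \<Rightarrow> part \<Rightarrow> bool" where
  "p < q \<longleftrightarrow> part_size p < part_size q \<or>
     (part_size p = part_size q \<and> overlined p \<and> \<not> overlined q)"

definition less_eq_part :: "part \<Rightarrow> part \<Rightarrow> bool" where
  "p \<le> q \<longleftrightarrow> p < q \<or> p = (q :: part)"

instance
proof
  fix p q r :: part
  show "p < q \<longleftrightarrow> p \<le> q \<and> \<not> q \<le> p"
    by (auto simp: less_part_def less_eq_part_def)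
  show "p \<le> p"
    by (simp add: less_eq_part_def)
  show "p \<le> q \<Longrightarrow> q \<le> r \<Longrightarrow> p \<le> r"
    by (auto simp: less_part_def less_eq_part_def)
  show "p \<le> q \<Longrightarrow> q \<le> p \<Longrightarrow> p = q"
    by (auto simp: less_part_def less_eq_part_def)
  show "p \<le> q \<or> q \<le> p"
    by (cases p; cases q) (auto simp: less_part_def less_eq_part_def)
qed

end

text \<open>Only one occurrence (conventionally the last) of each size may be overlined, so an
  overpartition is determined by the multiset of its parts, in which every overlined part has
  multiplicity at most one.\<close>

definition overpartitions :: "nat \<Rightarrow> part multiset set" where
  "overpartitions n =
     {L. (\<forall>p \<in># L. part_size p > 0) \<and> (\<forall>k. count L (Over k) \<le> 1) \<and>
         (\<Sum>p \<in># L. part_size p) = n}"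

definition A :: "nat \<Rightarrow> part multiset set" where
  "A n = {L \<in> overpartitions n. L \<noteq> {#} \<and> \<not> overlined (Min (set_mset L))}"

text \<open>The condition ``at least 2 plus the number of non-overlined ones'' is a comparison of parts in
  the order above: the bound is a plain part, and the overlined part of the same size is below it.
  Comparing sizes only would not do: then \<open>B 3\<close> would have 8 elements, whereas \<open>A 4\<close> has 7.\<close>

definition B :: "nat \<Rightarrow> part multiset set" where
  "B m = {L \<in> overpartitions m.
            Over 1 \<in># L \<and> (\<exists>p \<in># L. p > Plain 1) \<longrightarrow>
            Min {p \<in> set_mset L. p > Plain 1} \<ge> Plain (2 + count L (Plain 1))}"

definition C :: "nat \<Rightarrow> part multiset set" where
  "C m = overpartitions m - B m"

lemma C_altdef:
  "C m = {L \<in> overpartitions m.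
            Over 1 \<in># L \<and> (\<exists>p \<in># L. p > Plain 1) \<and>
            Min {p \<in> set_mset L. p > Plain 1} < Plain (2 + count L (Plain 1))}"
  by (auto simp: C_def B_def not_le)

end

(* Remove one copy of the smallest part k of an overpartition in A n; this part is plain. If k = 1,
   nothing more is done, and the images are the overpartitions of n - 1 without an overlined 1. If
   k > 1, add an overlined 1 and k - 2 plain ones: then k is recovered as 2 plus the number of plain
   ones, and the remaining parts are exactly those subject to the bound in B (n - 1). *)

theory Submission
  imports Defs
begin

text \<open>The witness \<open>Plain k\<close> forces nonemptiness by itself, so later arguments
  work with an explicit smallest part instead of \<open>Min\<close>.\<close>

lemma A_iff:
  "L \<in> A n \<longleftrightarrow> L \<in> overpartitions n \<and> (\<exists>k. Plain k \<in># L \<and> (\<forall>p \<in># L. Plain k \<le> p))"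
proof -
  have "L \<noteq> {#} \<and> \<not> overlined (Min (set_mset L)) \<longleftrightarrow>
        (\<exists>k. Plain k \<in># L \<and> (\<forall>p \<in># L. Plain k \<le> p))" (is "?l \<longleftrightarrow> ?r")
  proof
    assume l: ?l
    then have "Min (set_mset L) \<in># L" "\<forall>p \<in># L. Min (set_mset L) \<le> p"
      by auto
    with l show ?r
      by (cases "Min (set_mset L)") auto
  next
    assume ?r
    then obtain k where k: "Plain k \<in># L" "\<forall>p \<in># L. Plain k \<le> p"
      by blast
    then have "Min (set_mset L) = Plain k"
      by (intro Min_eqI) auto
    with k show ?l
      by auto
  qed
  then show ?thesis
    by (auto simp: A_def)
qed

text \<open>With no part above \<open>Plain 1\<close> the set under \<open>Min\<close> is empty, but
  then the quantified bound is vacuous and absorbs the existence guard.\<close>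

lemma B_iff:
  "M \<in> B m \<longleftrightarrow> M \<in> overpartitions m \<and>
     (Over 1 \<in># M \<longrightarrow> (\<forall>p \<in># M. p > Plain 1 \<longrightarrow> Plain (2 + count M (Plain 1)) \<le> p))"
proof -
  let ?S = "{p \<in> set_mset M. p > Plain 1}"
  have "b \<le> Min ?S \<longleftrightarrow> (\<forall>p \<in> ?S. b \<le> p)" if "\<exists>p \<in># M. p > Plain 1" for b
    using that by (intro Min_ge_iff) auto
  then show ?thesis
    unfolding B_def by blast
qed

lemma part_cases_Plain_1:
  assumes "part_size p > 0"
  obtains "p = Over 1" | "p = Plain 1" | "p > Plain 1"
  using assms by (cases p; cases "part_size p = 1") (auto simp: less_part_def)

text \<open>Positive sizes leave \<open>Over 1\<close> and \<open>Plain 1\<close> as the only parts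
  not above \<open>Plain 1\<close>, and \<open>Over 1\<close> occurs exactly once. Hence what
  \<open>restore_min\<close> keeps is enough to rebuild \<open>M\<close>.\<close>

lemma overpartition_decompose_ones:
  assumes "M \<in> overpartitions m" "Over 1 \<in># M"
  shows "M = {#Over 1#} + replicate_mset (count M (Plain 1)) (Plain 1)
             + filter_mset (\<lambda>p. p > Plain 1) M"
proof (rule multiset_eqI)
  fix p
  have "count M (Over 1) = 1"
    using assms by (intro antisym) (auto simp: overpartitions_def)
  moreover have "count M p = 0" if "part_size p = 0"
    using assms that by (auto simp: overpartitions_def count_eq_zero_iff)
  ultimately show "count M p = count ({#Over 1#} + replicate_mset (count M (Plain 1)) (Plain 1)
             + filter_mset (\<lambda>p. p > Plain 1) M) p"
    by (cases "part_size p = 0"; cases "part_size p = 1"; cases p) (auto simp: less_part_def)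
qed

text \<open>On \<open>A n\<close>, where \<open>k > 0\<close>, the added parts sum to
  \<open>k - 1\<close> in both branches, so the total drops by one; \<open>k - 2\<close> is never
  truncated.\<close>

definition trade_min :: "part multiset \<Rightarrow> part multiset" where
  "trade_min L = (let k = part_size (Min (set_mset L)) in
     (L - {#Plain k#}) + (if k = 1 then {#} else {#Over 1#} + replicate_mset (k - 2) (Plain 1)))"

text \<open>In an image of \<open>trade_min\<close>, \<open>Over 1\<close> signals that the removed
  part had size above 1; all ones were then inserted, so the filter may discard them.\<close>

definition restore_min :: "part multiset \<Rightarrow> part multiset" where
  "restore_min M = (if Over 1 \<in># M
     then add_mset (Plain (2 + count M (Plain 1))) (filter_mset (\<lambda>p. p > Plain 1) M)
     else add_mset (Plain 1) M)"

lemma trade_min_add: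
  assumes "\<forall>p \<in># L. Plain k \<le> p"
  shows "trade_min (add_mset (Plain k) L) =
     L + (if k = 1 then {#} else {#Over 1#} + replicate_mset (k - 2) (Plain 1))"
proof -
  have "Min (set_mset (add_mset (Plain k) L)) = Plain k"
    using assms by (intro Min_eqI) auto
  then show ?thesis
    unfolding trade_min_def Let_def by simp
qed

lemma overpartitions_add_Plain:
  "add_mset (Plain k) L \<in> overpartitions n \<longleftrightarrow> k > 0 \<and> k \<le> n \<and> L \<in> overpartitions (n - k)"
  by (auto simp: overpartitions_def)

lemma overpartitions_add_Over:
  "add_mset (Over k) L \<in> overpartitions n \<longleftrightarrow>
     k > 0 \<and> k \<le> n \<and> Over k \<notin># L \<and> L \<in> overpartitions (n - k)"
  by (auto simp: overpartitions_def not_in_iff split: if_splits)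

lemma overpartitions_add_ones:
  "L + replicate_mset i (Plain 1) \<in> overpartitions n \<longleftrightarrow> i \<le> n \<and> L \<in> overpartitions (n - i)"
  by (auto simp: overpartitions_def in_replicate_mset)

lemma trade_min_in_B_restore:
  assumes "L \<in> A n"
  shows "trade_min L \<in> B (n - 1) \<and> restore_min (trade_min L) = L"
proof -
  obtain k where L: "L \<in> overpartitions n" "Plain k \<in># L" "\<forall>p \<in># L. Plain k \<le> p"
    using assms by (auto simp: A_iff)
  then obtain L' where L': "L = add_mset (Plain k) L'"
    by (meson mset_add)
  have min: "\<forall>p \<in># L'. Plain k \<le> p"
    using L(3) L' by auto
  have op: "k > 0" "k \<le> n" "L' \<in> overpartitions (n - k)"
    using L(1) by (auto simp: L' overpartitions_add_Plain)
  show ?thesis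
  proof (cases "k = 1")
    case True
    \<comment> \<open>\<open>Over 1\<close> lies below the minimum \<open>Plain 1\<close>, so
      \<open>restore_min\<close> takes its second branch.\<close>
    then have "Over 1 \<notin># L'"
      using min by (auto simp: less_eq_part_def less_part_def)
    then show ?thesis
      using True op trade_min_add[OF min] by (simp add: L' B_iff restore_min_def)
  next
    case False
    define i where "i = k - 2"
    have k: "k = i + 2"
      using False op(1) by (simp add: i_def)
    \<comment> \<open>As \<open>k\<close> is at least 2, nothing left in \<open>L'\<close> is a one;
      the image contains exactly the \<open>i\<close> inserted plain ones.\<close>
    have gt: "\<forall>p \<in># L'. Plain 1 < p"
      using min k by (fastforce simp: less_eq_part_def less_part_def)
    then have ones: "Over 1 \<notin># L'" "count L' (Plain 1) = 0"
      by (auto simp: less_part_def count_eq_zero_iff)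
    have flt: "filter_mset ((<) (Plain 1)) (L' + replicate_mset i (Plain 1)) = L'"
      using gt by (subst filter_mset_eq_conv) (auto simp: in_replicate_mset)
    have tm: "trade_min L = add_mset (Over 1) (L' + replicate_mset i (Plain 1))"
      using trade_min_add[OF min] k by (simp add: L')
    have "trade_min L \<in> overpartitions (n - 1)"
      using op k ones by (auto simp: tm overpartitions_add_Over overpartitions_add_ones[simplified]
          in_replicate_mset)
    moreover have "restore_min (trade_min L) = L"
    proof -
      have "\<not> Plain 1 < Over 1"
        by (simp add: less_part_def)
      then show ?thesis
        unfolding tm restore_min_def using ones k flt by (simp add: L')
    qed
    \<comment> \<open>The bound is \<open>Plain (2 + i) = Plain k\<close>, so this is the minimality
      of the removed part.\<close>
    moreover have "\<forall>p \<in># trade_min L. p > Plain 1 \<longrightarrow> Plain (2 + count (trade_min L) (Plain 1)) \<le> p"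
      using min ones k by (auto simp: tm less_part_def in_replicate_mset)
    ultimately show ?thesis
      by (simp add: B_iff)
  qed
qed

lemma restore_min_in_A_trade:
  assumes "M \<in> B m"
  shows "restore_min M \<in> A (Suc m) \<and> trade_min (restore_min M) = M"
proof (cases "Over 1 \<in># M")
  case False
  have M: "M \<in> overpartitions m"
    using assms by (simp add: B_iff)
  \<comment> \<open>Only \<open>Over 1\<close> could lie below \<open>Plain 1\<close>, so the part
    added by \<open>restore_min\<close> is a minimum.\<close>
  have "Plain 1 \<le> p" if "p \<in># M" for p
  proof -
    have "part_size p > 0" using M that by (auto simp: overpartitions_def)
    then show ?thesis using that False by (cases rule: part_cases_Plain_1) auto
  qed
  then show ?thesis
    using M False by (auto simp: restore_min_def A_iff overpartitions_add_Plain trade_min_add)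
next
  case True
  define i where "i = count M (Plain 1)"
  define F where "F = filter_mset (\<lambda>p. p > Plain 1) M"
  \<comment> \<open>The condition defining \<open>B\<close> says precisely that
    \<open>Plain (2 + i)\<close> becomes a smallest part when added to \<open>F\<close>.\<close>
  have M: "M \<in> overpartitions m"
    and min: "\<forall>p \<in># F. Plain (2 + i) \<le> p"
    using assms True by (auto simp: B_iff F_def i_def)
  have dec: "M = add_mset (Over 1) (F + replicate_mset i (Plain 1))"
    using overpartition_decompose_ones[OF M True] by (simp add: F_def i_def add.commute)
  have rm: "restore_min M = add_mset (Plain (2 + i)) F"
    using True by (simp add: restore_min_def F_def i_def)
  \<comment> \<open>The ones removed from \<open>M\<close> weigh \<open>1 + i\<close> and are
    replaced by a part of size \<open>2 + i\<close>, which raises the total to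
    \<open>Suc m\<close>.\<close>
  have "m \<ge> 1 + i" "F \<in> overpartitions (m - 1 - i)"
    using M by (subst (asm) dec;
      auto simp: overpartitions_add_Over overpartitions_add_ones[simplified])+
  then have "restore_min M \<in> overpartitions (Suc m)"
    by (simp add: rm overpartitions_add_Plain)
  moreover have "trade_min (restore_min M) = M"
    using trade_min_add[OF min] by (subst dec) (simp add: rm)
  ultimately show ?thesis
    using min by (auto simp: A_iff rm)
qed

lemma bij_betw_trade_min: "n \<ge> 1 \<Longrightarrow> bij_betw trade_min (A n) (B (n - 1))"
  using trade_min_in_B_restore restore_min_in_A_trade[of _ "n - 1"]
  by (intro bij_betw_byWitness[where f' = restore_min]) auto

lemma C_nonempty:
  assumes "m \<ge> 3"
  shows "C m \<noteq> {}"
proof -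
  \<comment> \<open>\<open>Over 2\<close> violates the bound for any number of plain ones, as it
    lies below even \<open>Plain 2\<close>; \<open>m - 3\<close> ones fill up the total.\<close>
  let ?M = "add_mset (Over 1) ({#Over 2#} + replicate_mset (m - 3) (Plain 1))"
  have "?M \<in> overpartitions m"
    using assms by (auto simp: overpartitions_def)
  moreover have "?M \<notin> B m"
    by (auto simp: B_iff less_part_def less_eq_part_def)
  ultimately show ?thesis
    by (auto simp: C_def)
qed

theorem theorem3p1:
  "(\<forall>n::nat. n \<ge> 1 \<longrightarrow> (\<exists>f. bij_betw f (A n) (B (n - 1)))) \<and>
   (\<forall>n::nat. n \<ge> 4 \<longrightarrow> C (n - 1) \<noteq> {})"
  using bij_betw_trade_min C_nonempty by force

end
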